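(* Assume that $$\overline\alpha_\nu:=\sum_{r=1}^m\dot q_r\frac{\partial\alpha_\nu}{\partial\dot q_r}=\alpha_\nu\qquad\text{for each }\nu=1,\dots,k$$ (as functions of $(q_1,\dots,q_n,\dot q_1,\dots,\dot q_m,t)$). Then $$\sum_{i=1}^n\dot q_i\frac{\partial\mathcal L}{\partial\dot q_i}=\sum_{r=1}^m\dot q_r\frac{\partial\mathcal L^*}{\partial\dot q_r}$$ (the left-hand side being evaluated at $\dot q_{m+\nu}=\alpha_\nu$, $\nu=1,\dots,k$), so that $\mathcal E^*=\mathcal E$, and along every motion of the system the following energy equations hold: $$\frac{d\mathcal E}{dt}=-\frac{\partial\mathcal L}{\partial t},\qquad \frac{d\mathcal E^*}{dt}=-\frac{\partial\mathcal L^*}{\partial t}+\sum_{\nu=1}^k\frac{\partial\alpha_\nu}{\partial t}\frac{\partial T}{\partial\dot q_{m+\nu}}=-\frac{\partial\mathcal L}{\partial t}.$$ Moreover, in the stationary case, that is if $\dfrac{\partial\mathcal L}{\partial t}=0$ and $\dfrac{\partial\phi_\nu}{\partial t}=0$ for $\nu=1,\dots,k$, the quantity $\mathcal E=\mathcal E^*$ is conserved during the motion.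
   Context: A mechanical system has Lagrangian coordinates $q=(q_1,\dots,q_n)$, generalized velocities $\dot q=(\dot q_1,\dots,\dot q_n)$ and kinetic energy $T(q,\dot q,t)$; the generalized forces are $\partial U/\partial q_i$ for a function $U(q,t)$, and $\mathcal L=T+U$. It is subject to $k<n$ kinematic constraints $\phi_\nu(q,\dot q,t)=0$, $\nu=1,\dots,k$. Put $m=n-k$. It is assumed that $\det(\partial\phi_i/\partial\dot q_{m+j})_{i,j=1,\dots,k}\ne0$, so that the constraints can be put (on the domain considered) in the equivalent explicit form $\dot q_{m+\nu}=\alpha_\nu(q_1,\dots,q_n,\dot q_1,\dots,\dot q_m,t)$, $\nu=1,\dots,k$; in particular $\phi_\nu(q,\dot q_1,\dots,\dot q_m,\alpha_1,\dots,\alpha_k,t)=0$ identically. The restricted kinetic energy is $$T^*(q_1,\dots,q_n,\dot q_1,\dots,\dot q_m,t)=T(q_1,\dots,q_n,\dot q_1,\dots,\dot q_m,\alpha_1,\dots,\alpha_k,t),$$ where each $\alpha_\nu$ is evaluated at $(q_1,\dots,q_n,\dot q_1,\dots,\dot q_m,t)$, and the restricted Lagrangian is $\mathcal L^*=T^*+U$, a function of $(q_1,\dots,q_n,\dot q_1,\dots,\dot q_m,t)$. The two energy functions, both regarded as functions of $(q_1,\dots,q_n,\dot q_1,\dots,\dot q_m,t)$, are $$\mathcal E=\left.\left(\sum_{i=1}^n\dot q_i\frac{\partial\mathcal L}{\partial\dot q_i}-\mathcal L\right)\right|_{\dot q_{m+\nu}=\alpha_\nu,\ \nu=1,\dots,k},\qquad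 \mathcal E^*=\sum_{r=1}^m\dot q_r\frac{\partial\mathcal L^*}{\partial\dot q_r}-\mathcal L^*.$$ A motion is a twice continuously differentiable curve $q(t)$ satisfying the constraints and the equations of motion, in either of the following two forms: (i) there exist multipliers $\lambda_\nu(t)$ with $$\frac{d}{dt}\frac{\partial\mathcal L}{\partial\dot q_i}-\frac{\partial\mathcal L}{\partial q_i}=\sum_{\nu=1}^k\lambda_\nu\frac{\partial\phi_\nu}{\partial\dot q_i},\qquad i=1,\dots,n;$$ (ii) $$\frac{d}{dt}\frac{\partial\mathcal L^*}{\partial\dot q_r}-\frac{\partial\mathcal L^*}{\partial q_r}-\sum_{\nu=1}^k\frac{\partial\mathcal L^*}{\partial q_{m+\nu}}\frac{\partial\alpha_\nu}{\partial\dot q_r}-\sum_{\nu=1}^kB_r^\nu\frac{\partial T}{\partial\dot q_{m+\nu}}=0,\qquad r=1,\dots,m,$$ with $$B_r^\nu=\frac{d}{dt}\left(\frac{\partial\alpha_\nu}{\partial\dot q_r}\right)-\frac{\partial\alpha_\nu}{\partial q_r}-\sum_{\mu=1}^k\frac{\partial\alpha_\mu}{\partial\dot q_r}\frac{\partial\alpha_\nu}{\partial q_{m+\mu}}.$$ Here $d/dt$ is the total time derivative along the motion. The derivatives $\partial T/\partial\dot q_{m+\nu}$ and $\partial\mathcal L/\partial t$ are computed from the unrestricted functions $T(q,\dot q,t)$ and $\mathcal L(q,\dot q,t)$ and then evaluated at $\dot q_{m+\mu}=\alpha_\mu$. All functions are assumed as smooth as needed. *)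

theory Defs
  imports "HOL-Analysis.Analysis"
begin

text \<open>
  The \<open>n = m + k\<close> coordinates are indexed by the sum type \<^typ>\<open>'m + 'k\<close>: \<open>Inl r\<close> is the
  coordinate number \<open>r\<close> (independent velocity) and \<open>Inr \<nu>\<close> the coordinate number \<open>m + \<nu>\<close>.
  A state is a triple \<open>(q, v, t)\<close>, where \<open>v\<close> stands for \<open>dq/dt\<close>; in a reduced state \<open>v\<close> contains
  only the \<open>m\<close> independent velocities.
\<close>

type_synonym ('m, 'k) state = "(real^('m + 'k)) \<times> (real^('m + 'k)) \<times> real"
type_synonym ('m, 'k) rstate = "(real^('m + 'k)) \<times> (real^'m) \<times> real"

definition partial :: "'a::real_normed_vector \<Rightarrow> ('a \<Rightarrow> real) \<Rightarrow> 'a \<Rightarrow> real" where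
  "partial b f x = deriv (\<lambda>s. f (x + s *\<^sub>R b)) 0"

definition d_q :: "'n::finite \<Rightarrow> ((real^'n) \<times> 'v \<times> real \<Rightarrow> real) \<Rightarrow> (real^'n) \<times> 'v::real_normed_vector \<times> real \<Rightarrow> real" where
  "d_q i = partial (axis i 1, 0, 0)"

definition d_v :: "'i::finite \<Rightarrow> ('p \<times> (real^'i) \<times> real \<Rightarrow> real) \<Rightarrow> 'p::real_normed_vector \<times> (real^'i) \<times> real \<Rightarrow> real" where
  "d_v i = partial (0, axis i 1, 0)"

definition d_t :: "('p \<times> 'v \<times> real \<Rightarrow> real) \<Rightarrow> 'p::real_normed_vector \<times> 'v::real_normed_vector \<times> real \<Rightarrow> real" where
  "d_t = partial (0, 0, 1)"

text \<open>Functions of class \<open>C\<^sup>k\<close>; only meant for open sets \<open>S\<close>.\<close>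

fun Ck_on :: "nat \<Rightarrow> ('a::euclidean_space \<Rightarrow> real) \<Rightarrow> 'a set \<Rightarrow> bool" where
  "Ck_on 0 f S \<longleftrightarrow> continuous_on S f"
| "Ck_on (Suc j) f S \<longleftrightarrow> f differentiable_on S \<and> (\<forall>b\<in>Basis. Ck_on j (partial b f) S)"

definition join :: "real^'m \<Rightarrow> ('k \<Rightarrow> real) \<Rightarrow> real^('m::finite + 'k::finite)" where
  "join v w = (\<chi> i. case i of Inl r \<Rightarrow> v $ r | Inr \<nu> \<Rightarrow> w \<nu>)"

definition indep :: "real^('m::finite + 'k::finite) \<Rightarrow> real^'m" where
  "indep v = (\<chi> r. v $ Inl r)"

definition lift :: "('k \<Rightarrow> ('m, 'k) rstate \<Rightarrow> real) \<Rightarrow> ('m::finite, 'k::finite) rstate \<Rightarrow> ('m, 'k) state" where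
  "lift \<alpha> = (\<lambda>(q, v, t). (q, join v (\<lambda>\<nu>. \<alpha> \<nu> (q, v, t)), t))"

definition lagrangian ::
  "(('m, 'k) state \<Rightarrow> real) \<Rightarrow> ((real^('m + 'k)) \<times> real \<Rightarrow> real) \<Rightarrow> ('m::finite, 'k::finite) state \<Rightarrow> real" where
  "lagrangian T U = (\<lambda>(q, v, t). T (q, v, t) + U (q, t))"

definition restricted_kinetic_energy ::
  "(('m, 'k) state \<Rightarrow> real) \<Rightarrow> ('k \<Rightarrow> ('m, 'k) rstate \<Rightarrow> real) \<Rightarrow> ('m::finite, 'k::finite) rstate \<Rightarrow> real" where
  "restricted_kinetic_energy T \<alpha> x = T (lift \<alpha> x)"

definition restricted_lagrangian ::
  "(('m, 'k) state \<Rightarrow> real) \<Rightarrow> ((real^('m + 'k)) \<times> real \<Rightarrow> real) \<Rightarrow> ('k \<Rightarrow> ('m, 'k) rstate \<Rightarrow> real)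
    \<Rightarrow> ('m::finite, 'k::finite) rstate \<Rightarrow> real" where
  "restricted_lagrangian T U \<alpha> = (\<lambda>(q, v, t). restricted_kinetic_energy T \<alpha> (q, v, t) + U (q, t))"

text \<open>\<open>\<Sum>\<^sub>i v\<^sub>i \<partial>F/\<partial>v\<^sub>i\<close> over all velocities on which \<open>F\<close> depends.\<close>

definition v_dv :: "('p \<times> (real^'i) \<times> real \<Rightarrow> real) \<Rightarrow> 'p::real_normed_vector \<times> (real^'i::finite) \<times> real \<Rightarrow> real" where
  "v_dv F = (\<lambda>(q, v, t). \<Sum>i\<in>UNIV. v $ i * d_v i F (q, v, t))"

definition energy ::
  "(('m, 'k) state \<Rightarrow> real) \<Rightarrow> ((real^('m + 'k)) \<times> real \<Rightarrow> real) \<Rightarrow> ('k \<Rightarrow> ('m, 'k) rstate \<Rightarrow> real)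
    \<Rightarrow> ('m::finite, 'k::finite) rstate \<Rightarrow> real" where
  "energy T U \<alpha> x = v_dv (lagrangian T U) (lift \<alpha> x) - lagrangian T U (lift \<alpha> x)"

definition restricted_energy ::
  "(('m, 'k) state \<Rightarrow> real) \<Rightarrow> ((real^('m + 'k)) \<times> real \<Rightarrow> real) \<Rightarrow> ('k \<Rightarrow> ('m, 'k) rstate \<Rightarrow> real)
    \<Rightarrow> ('m::finite, 'k::finite) rstate \<Rightarrow> real" where
  "restricted_energy T U \<alpha> x = v_dv (restricted_lagrangian T U \<alpha>) x - restricted_lagrangian T U \<alpha> x"

definition state_along :: "(real \<Rightarrow> real^('m + 'k)) \<Rightarrow> real \<Rightarrow> ('m::finite, 'k::finite) state" where
  "state_along q t = (q t, vector_derivative q (at t), t)"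

definition rstate_along :: "(real \<Rightarrow> real^('m + 'k)) \<Rightarrow> real \<Rightarrow> ('m::finite, 'k::finite) rstate" where
  "rstate_along q t = (q t, indep (vector_derivative q (at t)), t)"

definition constrained_curve ::
  "('m, 'k) state set \<Rightarrow> ('k \<Rightarrow> ('m, 'k) state \<Rightarrow> real) \<Rightarrow> real set
    \<Rightarrow> (real \<Rightarrow> real^('m::finite + 'k::finite)) \<Rightarrow> bool" where
  "constrained_curve D \<phi> J q \<longleftrightarrow>
     open J \<and> is_interval J \<and> (\<forall>i. Ck_on 2 (\<lambda>t. q t $ i) J) \<and>
     (\<forall>t\<in>J. state_along q t \<in> D \<and> (\<forall>\<nu>. \<phi> \<nu> (state_along q t) = 0))"

definition multiplier_equations ::
  "(('m, 'k) state \<Rightarrow> real) \<Rightarrow> ((real^('m + 'k)) \<times> real \<Rightarrow> real) \<Rightarrow> ('k \<Rightarrow> ('m, 'k) state \<Rightarrow> real)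
    \<Rightarrow> real set \<Rightarrow> (real \<Rightarrow> real^('m::finite + 'k::finite)) \<Rightarrow> bool" where
  "multiplier_equations T U \<phi> J q \<longleftrightarrow>
     (\<exists>\<mu> :: 'k \<Rightarrow> real \<Rightarrow> real. \<forall>t\<in>J. \<forall>i.
        deriv (\<lambda>s. d_v i (lagrangian T U) (state_along q s)) t
          - d_q i (lagrangian T U) (state_along q t)
        = (\<Sum>\<nu>\<in>UNIV. \<mu> \<nu> t * d_v i (\<phi> \<nu>) (state_along q t)))"

definition B_coeff ::
  "('k \<Rightarrow> ('m, 'k) rstate \<Rightarrow> real) \<Rightarrow> (real \<Rightarrow> real^('m + 'k)) \<Rightarrow> 'm::finite \<Rightarrow> 'k::finite \<Rightarrow> real \<Rightarrow> real" where
  "B_coeff \<alpha> q r \<nu> t =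
     deriv (\<lambda>s. d_v r (\<alpha> \<nu>) (rstate_along q s)) t
     - d_q (Inl r) (\<alpha> \<nu>) (rstate_along q t)
     - (\<Sum>\<mu>\<in>UNIV. d_v r (\<alpha> \<mu>) (rstate_along q t) * d_q (Inr \<mu>) (\<alpha> \<nu>) (rstate_along q t))"

definition reduced_equations ::
  "(('m, 'k) state \<Rightarrow> real) \<Rightarrow> ((real^('m + 'k)) \<times> real \<Rightarrow> real) \<Rightarrow> ('k \<Rightarrow> ('m, 'k) rstate \<Rightarrow> real)
    \<Rightarrow> real set \<Rightarrow> (real \<Rightarrow> real^('m::finite + 'k::finite)) \<Rightarrow> bool" where
  "reduced_equations T U \<alpha> J q \<longleftrightarrow>
     (\<forall>t\<in>J. \<forall>r.
        deriv (\<lambda>s. d_v r (restricted_lagrangian T U \<alpha>) (rstate_along q s)) t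
        - d_q (Inl r) (restricted_lagrangian T U \<alpha>) (rstate_along q t)
        - (\<Sum>\<nu>\<in>UNIV. d_q (Inr \<nu>) (restricted_lagrangian T U \<alpha>) (rstate_along q t)
                      * d_v r (\<alpha> \<nu>) (rstate_along q t))
        - (\<Sum>\<nu>\<in>UNIV. B_coeff \<alpha> q r \<nu> t * d_v (Inr \<nu>) T (lift \<alpha> (rstate_along q t)))
        = 0)"

definition motion ::
  "('m, 'k) state set \<Rightarrow> (('m, 'k) state \<Rightarrow> real) \<Rightarrow> ((real^('m + 'k)) \<times> real \<Rightarrow> real)
    \<Rightarrow> ('k \<Rightarrow> ('m, 'k) state \<Rightarrow> real) \<Rightarrow> ('k \<Rightarrow> ('m, 'k) rstate \<Rightarrow> real)
    \<Rightarrow> real set \<Rightarrow> (real \<Rightarrow> real^('m::finite + 'k::finite)) \<Rightarrow> bool" where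
  "motion D T U \<phi> \<alpha> J q \<longleftrightarrow>
     constrained_curve D \<phi> J q \<and>
     (multiplier_equations T U \<phi> J q \<or> reduced_equations T U \<alpha> J q)"

text \<open>
  The standing assumptions. \<open>D\<close> is the domain of states, \<open>\<Omega>\<close> the domain of reduced states on
  which the explicit form of the constraints is considered; both may be small, so the explicit
  form may be only a local one. All functions are of class \<open>C\<^sup>2\<close>, which is as much as is needed.
\<close>

definition nonholonomic_system ::
  "('m, 'k) state set \<Rightarrow> ('m, 'k) rstate set \<Rightarrow> (('m, 'k) state \<Rightarrow> real)
    \<Rightarrow> ((real^('m + 'k)) \<times> real \<Rightarrow> real) \<Rightarrow> ('k \<Rightarrow> ('m, 'k) state \<Rightarrow> real)
    \<Rightarrow> ('k \<Rightarrow> ('m::finite, 'k::finite) rstate \<Rightarrow> real) \<Rightarrow> bool" where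
  "nonholonomic_system D \<Omega> T U \<phi> \<alpha> \<longleftrightarrow>
     open D \<and> open \<Omega> \<and>
     Ck_on 2 T D \<and> Ck_on 2 U ((\<lambda>(q, v, t). (q, t)) ` D) \<and>
     (\<forall>\<nu>. Ck_on 2 (\<phi> \<nu>) D) \<and> (\<forall>\<nu>. Ck_on 2 (\<alpha> \<nu>) \<Omega>) \<and>
     (\<forall>x\<in>D. det (\<chi> i j. d_v (Inr j) (\<phi> i) x) \<noteq> 0) \<and>
     (\<forall>x\<in>\<Omega>. lift \<alpha> x \<in> D) \<and>
     (\<forall>(q, v, t)\<in>D. (\<forall>\<nu>. \<phi> \<nu> (q, v, t) = 0) \<longleftrightarrow>
        (q, indep v, t) \<in> \<Omega> \<and> (\<forall>\<nu>. v $ Inr \<nu> = \<alpha> \<nu> (q, indep v, t)))"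

end

theory Submission
  imports Defs
begin

text \<open>
  For a function \<open>F(q, v, t)\<close> and any curve, \<open>d/dt (\<Sum> v\<^sub>i F\<^sub>v\<^sub>i - F) =
  \<Sum> v\<^sub>i d/dt F\<^sub>v\<^sub>i - \<Sum> q'\<^sub>i F\<^sub>q\<^sub>i - F\<^sub>t\<close>. With \<open>F = L\<close> and the equations with multipliers this
  leaves the power of the reactions, which vanishes: differentiating \<open>\<phi>(q, v, \<alpha>, t) = 0\<close> along
  \<open>v\<close> and using \<open>\<Sum> v\<^sub>r \<partial>\<alpha>/\<partial>v\<^sub>r = \<alpha>\<close> gives \<open>\<Sum> v\<^sub>i \<partial>\<phi>/\<partial>v\<^sub>i = 0\<close>. With \<open>F = L\<^sup>*\<close> and the reduced
  equations it leaves \<open>\<Sum>\<^sub>\<nu> T\<^sub>\<nu> \<Sum>\<^sub>r v\<^sub>r B\<^sub>r\<^sub>\<nu>\<close>. Finally \<open>F = \<alpha>\<^sub>\<nu>\<close>, for which \<open>\<Sum> v\<^sub>r F\<^sub>v\<^sub>r - F\<close> is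
  identically zero, shows \<open>\<Sum>\<^sub>r v\<^sub>r B\<^sub>r\<^sub>\<nu> = \<partial>\<alpha>\<^sub>\<nu>/\<partial>t\<close>.
\<close>

section \<open>Partial derivatives and the chain rule along curves\<close>

lemma partial_eq:
  assumes "(f has_derivative f') (at x)"
  shows "partial b f x = f' b"
proof -
  interpret f': bounded_linear f'
    using assms by (rule has_derivative_bounded_linear)
  have "((\<lambda>s. x + s *\<^sub>R b) has_derivative (\<lambda>s. s *\<^sub>R b)) (at 0)"
    by (auto intro!: derivative_eq_intros)
  moreover have "(f has_derivative f') (at (x + 0 *\<^sub>R b))"
    using assms by simp
  ultimately have "((\<lambda>s. f (x + s *\<^sub>R b)) has_derivative (\<lambda>s. f' (s *\<^sub>R b))) (at 0)"
    by (rule has_derivative_compose)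
  then have "((\<lambda>s. f (x + s *\<^sub>R b)) has_real_derivative f' b) (at 0)"
    by (simp add: has_field_derivative_def f'.scaleR mult_commute_abs)
  then show ?thesis
    by (simp add: partial_def DERIV_imp_deriv)
qed

lemma
  assumes "(f has_derivative f') (at x)"
  shows d_q_eq: "d_q i f x = f' (axis i 1, 0, 0)"
    and d_v_eq: "d_v j f x = f' (0, axis j 1, 0)"
    and d_t_eq: "d_t f x = f' (0, 0, 1)"
  using partial_eq[OF assms] by (simp_all add: d_q_def d_v_def d_t_def)

lemma differentiable_transform_open:
  assumes "f differentiable (at x)" "open S" "x \<in> S" "\<And>y. y \<in> S \<Longrightarrow> f y = g y"
  shows "g differentiable (at x)"
proof -
  obtain f' where "(f has_derivative f') (at x)"
    using assms(1) by (auto simp: differentiable_def)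
  then have "(g has_derivative f') (at x)"
    using assms(2-4) by (rule has_derivative_transform_within_open)
  then show ?thesis
    by (auto simp: differentiable_def)
qed

text \<open>By linearity a direction splits into its position, velocity and time parts, and the
  first two expand in the standard basis. The explicit form makes every later chain rule a
  computation with \<open>d_q\<close>, \<open>d_v\<close> and \<open>d_t\<close>.\<close>

lemma has_derivative_partials:
  fixes F :: "(real^'n) \<times> (real^'i) \<times> real \<Rightarrow> real"
  assumes "F differentiable (at x)"
  shows "(F has_derivative (\<lambda>(u, w, r). (\<Sum>i\<in>UNIV. u $ i * d_q i F x)
    + (\<Sum>j\<in>UNIV. w $ j * d_v j F x) + r * d_t F x)) (at x)"
proof -
  obtain F' where F': "(F has_derivative F') (at x)"
    using assms by (auto simp: differentiable_def)
  interpret F': bounded_linear F'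
    using F' by (rule has_derivative_bounded_linear)
  have "F' (u, w, r) = (\<Sum>i\<in>UNIV. u $ i * d_q i F x) + (\<Sum>j\<in>UNIV. w $ j * d_v j F x) + r * d_t F x"
    for u w r
  proof -
    have "F' (u, w, r) = F' ((u, 0, 0) + (0, w, 0) + (0, 0, r))"
      by simp
    also have "\<dots> = F' (u, 0, 0) + F' (0, w, 0) + F' (0, 0, r)"
      by (simp only: F'.add)
    also have "F' (u, 0, 0) = (\<Sum>i\<in>UNIV. u $ i * d_q i F x)"
    proof -
      have u: "(u, 0, 0) = (\<Sum>i\<in>UNIV. u $ i *\<^sub>R (axis i 1, 0 :: real^'i, 0 :: real))"
        using basis_expansion[of u] by (simp add: prod_eq_iff fst_sum snd_sum scalar_mult_eq_scaleR)
      \<comment> \<open>\<open>scaleR_Pair\<close> is removed so that the scalars stay outside the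
        triples, where linearity of \<open>F'\<close> can extract them.\<close>
      then show ?thesis
        by (subst u) (simp add: F'.sum F'.scaleR d_q_eq[OF F'] del: scaleR_Pair)
    qed
    also have "F' (0, w, 0) = (\<Sum>j\<in>UNIV. w $ j * d_v j F x)"
    proof -
      have w: "(0, w, 0) = (\<Sum>j\<in>UNIV. w $ j *\<^sub>R (0 :: real^'n, axis j 1, 0 :: real))"
        using basis_expansion[of w] by (simp add: prod_eq_iff fst_sum snd_sum scalar_mult_eq_scaleR)
      then show ?thesis
        by (subst w) (simp add: F'.sum F'.scaleR d_v_eq[OF F'] del: scaleR_Pair)
    qed
    also have "F' (0, 0, r) = r * d_t F x"
      using F'.scaleR[of r "(0, 0, 1)"] by (simp add: d_t_eq[OF F'])
    finally show ?thesis .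
  qed
  then have "F' = (\<lambda>(u, w, r). (\<Sum>i\<in>UNIV. u $ i * d_q i F x)
    + (\<Sum>j\<in>UNIV. w $ j * d_v j F x) + r * d_t F x)"
    by auto
  with F' show ?thesis by simp
qed

lemma has_real_derivative_along:
  fixes F :: "(real^'n) \<times> (real^'i) \<times> real \<Rightarrow> real"
  assumes "F differentiable (at (a t, b t, t))"
    and "(a has_vector_derivative a') (at t)" "(b has_vector_derivative b') (at t)"
  shows "((\<lambda>s. F (a s, b s, s)) has_real_derivative
    (\<Sum>i\<in>UNIV. a' $ i * d_q i F (a t, b t, t)) + (\<Sum>j\<in>UNIV. b' $ j * d_v j F (a t, b t, t))
    + d_t F (a t, b t, t)) (at t)"
proof -
  have "((\<lambda>s. (a s, b s, s)) has_derivative (\<lambda>h. (h *\<^sub>R a', h *\<^sub>R b', h))) (at t)"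
    using assms(2,3) unfolding has_vector_derivative_def
    by (intro has_derivative_Pair has_derivative_ident)
  from has_derivative_compose[OF this has_derivative_partials[OF assms(1)]] show ?thesis
    unfolding has_field_derivative_def
    by (rule has_derivative_eq_rhs) (simp add: fun_eq_iff algebra_simps sum_distrib_left)
qed

text \<open>The terms with the derivative of \<open>b\<close> arising from the product rule cancel
  those in the chain rule for \<open>F\<close>, so no acceleration remains. The velocity
  \<open>a'\<close> of the base curve is separate from \<open>b\<close> because the lemma serves
  both full states, where \<open>b\<close> is the whole velocity, and reduced states, where
  \<open>b\<close> is only its independent part.\<close>

lemma v_dv_minus_has_real_derivative:
  fixes F :: "(real^'n) \<times> (real^'i) \<times> real \<Rightarrow> real"
  assumes F: "F differentiable (at (a t, b t, t))"
    and F_v: "\<And>i. (\<lambda>s. d_v i F (a s, b s, s)) differentiable (at t)"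
    and a: "(a has_vector_derivative a') (at t)" and b: "b differentiable (at t)"
  shows "((\<lambda>s. v_dv F (a s, b s, s) - F (a s, b s, s)) has_real_derivative
    (\<Sum>i\<in>UNIV. b t $ i * deriv (\<lambda>s. d_v i F (a s, b s, s)) t)
    - (\<Sum>i\<in>UNIV. a' $ i * d_q i F (a t, b t, t)) - d_t F (a t, b t, t)) (at t)"
proof -
  obtain b' where b': "(b has_vector_derivative b') (at t)"
    using b vector_derivative_works by blast
  have b'_nth: "((\<lambda>s. b s $ i) has_real_derivative b' $ i) (at t)" for i
    using bounded_linear.has_vector_derivative[OF bounded_linear_vec_nth b', of i]
    by (simp add: has_real_derivative_iff_has_vector_derivative)
  have "((\<lambda>s. d_v i F (a s, b s, s)) has_real_derivative deriv (\<lambda>s. d_v i F (a s, b s, s)) t) (at t)"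
    for i
    using F_v[of i] DERIV_deriv_iff_real_differentiable by blast
  note [derivative_intros] = this b'_nth has_real_derivative_along[OF F a b']
  show ?thesis
    unfolding v_dv_def prod.case
    by (rule derivative_eq_intros refl)+ (simp add: sum.distrib algebra_simps)
qed

section \<open>Pointwise differentiability from \<open>Ck_on\<close>\<close>

lemma Ck_on_Suc_differentiable:
  assumes "Ck_on (Suc j) f S" "open S" "x \<in> S"
  shows "f differentiable (at x)"
  using assms by (auto simp: differentiable_on_eq_differentiable_at)

lemma Ck_on_2_partial_differentiable:
  assumes "Ck_on 2 f S" "open S" "x \<in> S" "b \<in> Basis"
  shows "partial b f differentiable (at x)"
  using assms by (auto simp: numeral_2_eq_2 differentiable_on_eq_differentiable_at)

lemma d_v_differentiable:
  fixes F :: "(real^'n) \<times> (real^'i) \<times> real \<Rightarrow> real"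
  assumes "Ck_on 2 F S" "open S" "x \<in> S"
  shows "d_v i F differentiable (at x)"
  unfolding d_v_def
  by (rule Ck_on_2_partial_differentiable[OF assms])
    (auto simp: Basis_prod_def axis_in_Basis_iff image_iff)

section \<open>Independent and dependent coordinates\<close>

lemma sum_UNIV_Plus:
  fixes f :: "'m::finite + 'k::finite \<Rightarrow> real"
  shows "(\<Sum>i\<in>UNIV. f i) = (\<Sum>r\<in>UNIV. f (Inl r)) + (\<Sum>\<nu>\<in>UNIV. f (Inr \<nu>))"
  by (simp add: UNIV_Plus_UNIV[symmetric] sum.Plus del: UNIV_Plus_UNIV)

lemma join_nth [simp]: "join v w $ Inl r = v $ r" "join v w $ Inr \<nu> = w \<nu>"
  by (simp_all add: join_def)

lemma join_indep: "(\<And>\<nu>. v $ Inr \<nu> = w \<nu>) \<Longrightarrow> join (indep v) w = v"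
  by (auto simp: vec_eq_iff join_def indep_def split: sum.split)

lemma indep_join [simp]: "indep (join v w) = v"
  by (simp add: indep_def join_def)

lemma bounded_linear_indep: "bounded_linear indep"
  by (simp add: linear_conv_bounded_linear[symmetric] linear_iff indep_def vec_eq_iff)

lemma has_derivative_vecI:
  fixes f :: "'a::real_normed_vector \<Rightarrow> real^'n"
  assumes "\<And>i. ((\<lambda>x. f x $ i) has_derivative (\<lambda>h. f' h $ i)) (at z within S)"
  shows "(f has_derivative f') (at z within S)"
  by (subst has_derivative_componentwise_within) (simp add: Basis_vec_def inner_axis assms)

lemma has_derivative_join:
  fixes v :: "'a::real_normed_vector \<Rightarrow> real^'m" and w :: "'k::finite \<Rightarrow> 'a \<Rightarrow> real"
  assumes "(v has_derivative v') (at z within S)" "\<And>\<nu>. (w \<nu> has_derivative w' \<nu>) (at z within S)"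
  shows "((\<lambda>x. join (v x) (\<lambda>\<nu>. w \<nu> x)) has_derivative (\<lambda>h. join (v' h) (\<lambda>\<nu>. w' \<nu> h))) (at z within S)"
proof (rule has_derivative_vecI)
  show "((\<lambda>x. join (v x) (\<lambda>\<nu>. w \<nu> x) $ i) has_derivative (\<lambda>h. join (v' h) (\<lambda>\<nu>. w' \<nu> h) $ i)) (at z within S)" for i
    using assms(2) bounded_linear.has_derivative[OF bounded_linear_vec_nth assms(1)]
    by (cases i) simp_all
qed

lemma has_derivative_lift:
  fixes \<alpha> :: "'k \<Rightarrow> ('m::finite, 'k::finite) rstate \<Rightarrow> real"
  assumes "\<And>\<nu>. (\<alpha> \<nu> has_derivative \<alpha>' \<nu>) (at x)"
  shows "(lift \<alpha> has_derivative (\<lambda>(u, w, r). (u, join w (\<lambda>\<nu>. \<alpha>' \<nu> (u, w, r)), r))) (at x)"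
proof -
  have "((\<lambda>y. (fst y, join (fst (snd y)) (\<lambda>\<nu>. \<alpha> \<nu> y), snd (snd y))) has_derivative
      (\<lambda>h. (fst h, join (fst (snd h)) (\<lambda>\<nu>. \<alpha>' \<nu> h), snd (snd h)))) (at x)"
    by (intro has_derivative_Pair has_derivative_join assms) (auto intro!: derivative_eq_intros)
  then show ?thesis
    by (simp add: lift_def case_prod_unfold)
qed

section \<open>Functions composed with the explicit constraints\<close>

context
  fixes F :: "('m::finite, 'k::finite) state \<Rightarrow> real" and \<alpha> :: "'k \<Rightarrow> ('m, 'k) rstate \<Rightarrow> real" and x
  assumes F: "F differentiable (at (lift \<alpha> x))" and \<alpha>: "\<And>\<nu>. \<alpha> \<nu> differentiable (at x)"
begin

text \<open>The lifted state changes its dependent velocities by the differential of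
  \<open>\<alpha>\<close>, so each \<open>d_v (Inr \<nu>) F\<close> is weighted by that
  differential.\<close>

lemma has_derivative_compose_lift:
  "((\<lambda>y. F (lift \<alpha> y)) has_derivative (\<lambda>(u, w, r).
     (\<Sum>i\<in>UNIV. u $ i * d_q i F (lift \<alpha> x)) + (\<Sum>s\<in>UNIV. w $ s * d_v (Inl s) F (lift \<alpha> x))
     + (\<Sum>\<nu>\<in>UNIV. ((\<Sum>i\<in>UNIV. u $ i * d_q i (\<alpha> \<nu>) x) + (\<Sum>s\<in>UNIV. w $ s * d_v s (\<alpha> \<nu>) x)
         + r * d_t (\<alpha> \<nu>) x) * d_v (Inr \<nu>) F (lift \<alpha> x))
     + r * d_t F (lift \<alpha> x))) (at x)"
  by (rule has_derivative_eq_rhs[OF has_derivative_compose[OF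
        has_derivative_lift[OF has_derivative_partials[OF \<alpha>]] has_derivative_partials[OF F]]])
    (auto simp: fun_eq_iff sum_UNIV_Plus)

lemma d_v_compose_lift:
  "d_v r (\<lambda>y. F (lift \<alpha> y)) x
    = d_v (Inl r) F (lift \<alpha> x) + (\<Sum>\<nu>\<in>UNIV. d_v r (\<alpha> \<nu>) x * d_v (Inr \<nu>) F (lift \<alpha> x))"
  unfolding d_v_eq[OF has_derivative_compose_lift]
  by (simp add: axis_def if_distrib[of "\<lambda>c. c * _"] cong: if_cong)

lemma d_t_compose_lift:
  "d_t (\<lambda>y. F (lift \<alpha> y)) x
    = d_t F (lift \<alpha> x) + (\<Sum>\<nu>\<in>UNIV. d_t (\<alpha> \<nu>) x * d_v (Inr \<nu>) F (lift \<alpha> x))"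
  unfolding d_t_eq[OF has_derivative_compose_lift]
  by (simp add: add.commute)

text \<open>Contracting \<open>d_v_compose_lift\<close> with the independent velocities puts the
  weight \<open>v_dv (\<alpha> \<nu>) x\<close> on \<open>d_v (Inr \<nu>) F\<close>. Under the
  assumption this weight is \<open>\<alpha> \<nu> x\<close>, which is exactly the dependent velocity
  of the lifted state. Applied to the Lagrangian it identifies the two energies; applied to
  \<open>\<phi>\<close> it makes the reactions powerless.\<close>

lemma v_dv_compose_lift:
  assumes "\<And>\<nu>. v_dv (\<alpha> \<nu>) x = \<alpha> \<nu> x"
  shows "v_dv (\<lambda>y. F (lift \<alpha> y)) x = v_dv F (lift \<alpha> x)"
proof -
  obtain q v t where x: "x = (q, v, t)"
    by (cases x)
  have "v_dv (\<lambda>y. F (lift \<alpha> y)) x = (\<Sum>r\<in>UNIV. v $ r * d_v (Inl r) F (lift \<alpha> x))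
      + (\<Sum>r\<in>UNIV. \<Sum>\<nu>\<in>UNIV. v $ r * d_v r (\<alpha> \<nu>) x * d_v (Inr \<nu>) F (lift \<alpha> x))"
    by (simp add: v_dv_def x d_v_compose_lift[unfolded x] distrib_left sum.distrib
        sum_distrib_left mult.assoc)
  also have "(\<Sum>r\<in>UNIV. \<Sum>\<nu>\<in>UNIV. v $ r * d_v r (\<alpha> \<nu>) x * d_v (Inr \<nu>) F (lift \<alpha> x))
      = (\<Sum>\<nu>\<in>UNIV. v_dv (\<alpha> \<nu>) x * d_v (Inr \<nu>) F (lift \<alpha> x))"
    by (subst sum.swap) (simp add: v_dv_def x sum_distrib_right)
  \<comment> \<open>The assumption is applied first, while \<open>v_dv (\<alpha> \<nu>) x\<close> is
    still folded; only then is \<open>v_dv\<close> expanded.\<close>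
  finally show ?thesis
    by (simp add: assms) (simp add: v_dv_def x lift_def sum_UNIV_Plus)
qed

end

section \<open>The Lagrangians and the regularity of curves\<close>

lemma restricted_lagrangian_eq: "restricted_lagrangian T U \<alpha> = (\<lambda>x. lagrangian T U (lift \<alpha> x))"
  by (auto simp: restricted_lagrangian_def restricted_kinetic_energy_def lagrangian_def lift_def)

text \<open>Smoothness of a curve is given by components and through \<open>partial 1\<close>, while
  states contain \<open>vector_derivative\<close>. Both derivatives agree on the open set
  \<open>J\<close>, so differentiability carries over from one to the other.\<close>

lemma C2_curve_has_vector_derivative:
  fixes q :: "real \<Rightarrow> real^'n"
  assumes q: "\<And>i. Ck_on 2 (\<lambda>s. q s $ i) J" and J: "open J" and "t \<in> J"
  shows "(q has_vector_derivative vector_derivative q (at t)) (at t)"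
    and "(\<lambda>s. vector_derivative q (at s)) differentiable (at t)"
proof -
  have nth: "(\<lambda>s. q s $ i) differentiable (at s)" if "s \<in> J" for i s
    using Ck_on_Suc_differentiable[OF _ J that] q[of i] by (simp only: numeral_2_eq_2)
  have q': "(q has_vector_derivative vector_derivative q (at s)) (at s)" if "s \<in> J" for s
    using nth[OF that]
    by (subst vector_derivative_works[symmetric])
      (auto simp: differentiable_componentwise_within[of q] Basis_vec_def inner_axis)
  show "(q has_vector_derivative vector_derivative q (at t)) (at t)"
    by (rule q'[OF \<open>t \<in> J\<close>])
  have "partial 1 (\<lambda>s. q s $ i) s = vector_derivative q (at s) $ i" if "s \<in> J" for i s
  proof -
    have "((\<lambda>s. q s $ i) has_derivative (\<lambda>h. (h *\<^sub>R vector_derivative q (at s)) $ i)) (at s)"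
      using q'[OF that] unfolding has_vector_derivative_def
      by (rule bounded_linear.has_derivative[OF bounded_linear_vec_nth])
    from partial_eq[OF this] show ?thesis by simp
  qed
  then have "(\<lambda>s. vector_derivative q (at s) $ i) differentiable (at t)" for i
    by (intro differentiable_transform_open[OF
          Ck_on_2_partial_differentiable[OF q[of i] J \<open>t \<in> J\<close>, of 1] J \<open>t \<in> J\<close>]) simp_all
  then show "(\<lambda>s. vector_derivative q (at s)) differentiable (at t)"
    by (auto simp: differentiable_componentwise_within[of "\<lambda>s. vector_derivative q (at s)"]
        Basis_vec_def inner_axis)
qed

text \<open>\<open>U\<close> is smooth on the projection of \<open>D\<close> that forgets
  velocities. This projection is open, being the image of an open set under a surjective linear map,
  so \<open>U\<close> is differentiable at each of its points. Since \<open>U\<close> ignores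
  velocities, \<open>d_v i\<close> of the Lagrangian coincides with \<open>d_v i T\<close> on all of
  \<open>D\<close> and inherits its differentiability.\<close>

lemma
  fixes T :: "('m::finite, 'k::finite) state \<Rightarrow> real"
  assumes T: "Ck_on 2 T D" and U: "Ck_on 2 U ((\<lambda>(q, v, t). (q, t)) ` D)"
    and D: "open D" and x: "x \<in> D"
  shows lagrangian_differentiable: "lagrangian T U differentiable (at x)"
    and d_v_lagrangian: "d_v i (lagrangian T U) x = d_v i T x"
    and d_v_lagrangian_differentiable: "d_v i (lagrangian T U) differentiable (at x)"
proof -
  \<comment> \<open>The contribution of \<open>U\<close> is kept as \<open>U'\<close> after the
    projection: a pure velocity direction projects to zero, where the linear \<open>U'\<close>
    vanishes.\<close>
  have deriv: "\<exists>T' U'. (T has_derivative T') (at x) \<and> linear U' \<and>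
      (lagrangian T U has_derivative (\<lambda>h. T' h + U' (fst h, snd (snd h)))) (at x)"
    if x: "x \<in> D" for x
  proof -
    let ?\<pi> = "\<lambda>x :: ('m, 'k) state. (fst x, snd (snd x))"
    have \<pi>: "(\<lambda>(q, v, t). (q, t)) ` D = ?\<pi> ` D"
      by (simp add: case_prod_unfold)
    have "open (?\<pi> ` D)"
    proof (rule open_surjective_linear_image[OF D])
      show "linear ?\<pi>"
        by (simp add: linear_iff)
      show "surj ?\<pi>"
        by (rule surjI[of _ "\<lambda>(q, t). (q, 0, t)"]) auto
    qed
    then have "U differentiable (at (?\<pi> x))"
      using Ck_on_Suc_differentiable[of 1 U "?\<pi> ` D" "?\<pi> x"] U x unfolding \<pi>
      by (simp add: numeral_2_eq_2)
    then obtain U' where U': "(U has_derivative U') (at (?\<pi> x))"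
      by (auto simp: differentiable_def)
    obtain T' where T': "(T has_derivative T') (at x)"
      using Ck_on_Suc_differentiable[of 1 T D x] T D x
      by (auto simp: numeral_2_eq_2 differentiable_def)
    have "(?\<pi> has_derivative ?\<pi>) (at x)"
      by (auto intro!: derivative_eq_intros)
    from has_derivative_add[OF T' has_derivative_compose[OF this U']]
    have "(lagrangian T U has_derivative (\<lambda>h. T' h + U' (?\<pi> h))) (at x)"
      by (simp add: lagrangian_def case_prod_unfold)
    with T' has_derivative_linear[OF U'] show ?thesis
      by blast
  qed
  show "lagrangian T U differentiable (at x)"
    using deriv[OF x] by (auto simp: differentiable_def)
  have eq: "d_v i (lagrangian T U) y = d_v i T y" if y: "y \<in> D" for y
  proof -
    obtain T' U' where T': "(T has_derivative T') (at y)" and U': "linear U'"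
      and L': "(lagrangian T U has_derivative (\<lambda>h. T' h + U' (fst h, snd (snd h)))) (at y)"
      using deriv[OF y] by blast
    show ?thesis
      unfolding d_v_eq[OF T'] d_v_eq[OF L'] using linear_0[OF U'] by (simp add: zero_prod_def)
  qed
  show "d_v i (lagrangian T U) x = d_v i T x"
    by (rule eq[OF x])
  show "d_v i (lagrangian T U) differentiable (at x)"
    by (rule differentiable_transform_open[OF d_v_differentiable[OF T D x] D x]) (simp add: eq)
qed

section \<open>Identities on the reduced domain\<close>

locale homogeneous_system =
  fixes D :: "('m::finite, 'k::finite) state set" and \<Omega> :: "('m, 'k) rstate set"
    and T :: "('m, 'k) state \<Rightarrow> real" and U :: "(real^('m + 'k)) \<times> real \<Rightarrow> real"
    and \<phi> :: "'k \<Rightarrow> ('m, 'k) state \<Rightarrow> real" and \<alpha> :: "'k \<Rightarrow> ('m, 'k) rstate \<Rightarrow> real"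
  assumes system: "nonholonomic_system D \<Omega> T U \<phi> \<alpha>"
    and homogeneous: "\<And>\<nu> x. x \<in> \<Omega> \<Longrightarrow> v_dv (\<alpha> \<nu>) x = \<alpha> \<nu> x"
begin

abbreviation "L \<equiv> lagrangian T U"
abbreviation "L' \<equiv> restricted_lagrangian T U \<alpha>"

lemma open_D: "open D" and open_\<Omega>: "open \<Omega>"
  and C2: "Ck_on 2 T D" "Ck_on 2 U ((\<lambda>(q, v, t). (q, t)) ` D)" "Ck_on 2 (\<phi> \<nu>) D" "Ck_on 2 (\<alpha> \<nu>) \<Omega>"
  and lift_in_D: "x \<in> \<Omega> \<Longrightarrow> lift \<alpha> x \<in> D"
  and explicit: "(q, v, t) \<in> D \<Longrightarrow> (\<forall>\<nu>. \<phi> \<nu> (q, v, t) = 0) \<longleftrightarrow>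
        (q, indep v, t) \<in> \<Omega> \<and> (\<forall>\<nu>. v $ Inr \<nu> = \<alpha> \<nu> (q, indep v, t))"
  using system by (auto simp: nonholonomic_system_def)

lemmas L_differentiable = lagrangian_differentiable[OF C2(1,2) open_D]
lemmas d_v_L = d_v_lagrangian[OF C2(1,2) open_D]
lemmas d_v_L_differentiable = d_v_lagrangian_differentiable[OF C2(1,2) open_D]

lemma \<phi>_differentiable: "x \<in> D \<Longrightarrow> \<phi> \<nu> differentiable (at x)"
  using Ck_on_Suc_differentiable[OF _ open_D, of 1 "\<phi> \<nu>" x] C2(3)[of \<nu>] by (simp add: numeral_2_eq_2)

lemma \<alpha>_differentiable: "x \<in> \<Omega> \<Longrightarrow> \<alpha> \<nu> differentiable (at x)"
  using Ck_on_Suc_differentiable[OF _ open_\<Omega>, of 1 "\<alpha> \<nu>" x] C2(4)[of \<nu>] by (simp add: numeral_2_eq_2)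

lemma d_v_\<alpha>_differentiable: "x \<in> \<Omega> \<Longrightarrow> d_v r (\<alpha> \<nu>) differentiable (at x)"
  by (rule d_v_differentiable[OF C2(4) open_\<Omega>])

lemma lift_differentiable: "x \<in> \<Omega> \<Longrightarrow> lift \<alpha> differentiable (at x)"
  unfolding differentiable_def
  by (rule exI, rule has_derivative_lift, rule has_derivative_partials, rule \<alpha>_differentiable)

text \<open>The composition of \<open>\<phi> \<nu>\<close> with \<open>lift \<alpha>\<close> is zero
  on the open set \<open>\<Omega>\<close>, so all its derivatives vanish there, and
  \<open>v_dv_compose_lift\<close> transfers this to \<open>\<phi> \<nu>\<close> itself. Hence the
  reactions have zero power for any multipliers.\<close>

lemma v_dv_\<phi>:
  assumes x: "x \<in> \<Omega>"
  shows "v_dv (\<phi> \<nu>) (lift \<alpha> x) = 0"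
proof -
  \<comment> \<open>The equivalence \<open>explicit\<close> is used from right to left at the lifted
    state, whose independent velocities are again those of \<open>y\<close>.\<close>
  have \<phi>_lift: "\<phi> \<nu> (lift \<alpha> y) = 0" if "y \<in> \<Omega>" for y
    using explicit[of "fst y" "join (fst (snd y)) (\<lambda>\<nu>. \<alpha> \<nu> y)" "snd (snd y)"] lift_in_D[OF that] that
    by (simp add: lift_def case_prod_unfold)
  have "((\<lambda>y. \<phi> \<nu> (lift \<alpha> y)) has_derivative (\<lambda>h. 0)) (at x)"
    by (rule has_derivative_transform_within_open[OF _ open_\<Omega> x, of "\<lambda>_. 0"])
      (auto simp: \<phi>_lift)
  then have "v_dv (\<lambda>y. \<phi> \<nu> (lift \<alpha> y)) x = 0"
    by (simp add: v_dv_def d_v_eq case_prod_unfold)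
  then show ?thesis
    using v_dv_compose_lift[OF \<phi>_differentiable[OF lift_in_D[OF x]] \<alpha>_differentiable[OF x] homogeneous[OF x]]
    by simp
qed

lemma L'_differentiable: "x \<in> \<Omega> \<Longrightarrow> L' differentiable (at x)"
  unfolding restricted_lagrangian_eq
  by (rule differentiable_compose[OF L_differentiable[OF lift_in_D] lift_differentiable])

text \<open>On all of \<open>\<Omega>\<close> the function \<open>d_v r L'\<close> is given by the
  chain rule formula \<open>?G\<close>, which is built from differentiable functions; openness of
  \<open>\<Omega>\<close> transfers the differentiability.\<close>

lemma d_v_L'_differentiable:
  assumes x: "x \<in> \<Omega>"
  shows "d_v r L' differentiable (at x)"
proof -
  let ?G = "\<lambda>y. d_v (Inl r) L (lift \<alpha> y) + (\<Sum>\<nu>\<in>UNIV. d_v r (\<alpha> \<nu>) y * d_v (Inr \<nu>) L (lift \<alpha> y))"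
  have "(\<lambda>y. d_v i L (lift \<alpha> y)) differentiable (at x)" for i
    by (rule differentiable_compose[OF d_v_L_differentiable[OF lift_in_D] lift_differentiable]) (rule x)+
  then have "?G differentiable (at x)"
    by (intro differentiable_add differentiable_sum ballI differentiable_mult d_v_\<alpha>_differentiable x) simp_all
  moreover have "?G y = d_v r L' y" if "y \<in> \<Omega>" for y
    unfolding restricted_lagrangian_eq
    by (rule d_v_compose_lift[OF L_differentiable[OF lift_in_D[OF that]] \<alpha>_differentiable[OF that], symmetric])
  ultimately show ?thesis
    by (rule differentiable_transform_open[OF _ open_\<Omega> x])
qed

lemma v_dv_L: "x \<in> \<Omega> \<Longrightarrow> v_dv L (lift \<alpha> x) = v_dv L' x"
  unfolding restricted_lagrangian_eq
  by (rule v_dv_compose_lift[OF L_differentiable[OF lift_in_D] \<alpha>_differentiable homogeneous, symmetric])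

lemma energies_eq: "x \<in> \<Omega> \<Longrightarrow> restricted_energy T U \<alpha> x = energy T U \<alpha> x"
  by (simp add: restricted_energy_def energy_def v_dv_L) (simp add: restricted_lagrangian_eq)

text \<open>The chain rule in time produces \<open>d_t (\<alpha> \<nu>)\<close> times the velocity
  derivatives of \<open>L\<close>, which are those of \<open>T\<close> because \<open>U\<close> is
  free of velocities. The added sum cancels exactly these terms.\<close>

lemma d_t_L':
  assumes x: "x \<in> \<Omega>"
  shows "- d_t L' x + (\<Sum>\<nu>\<in>UNIV. d_t (\<alpha> \<nu>) x * d_v (Inr \<nu>) T (lift \<alpha> x)) = - d_t L (lift \<alpha> x)"
  unfolding restricted_lagrangian_eq
  by (simp add: d_t_compose_lift[OF L_differentiable[OF lift_in_D] \<alpha>_differentiable] d_v_L lift_in_D x)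

section \<open>Energy rates along a constrained curve\<close>

context
  fixes J :: "real set" and q :: "real \<Rightarrow> real^('m + 'k)"
  assumes curve: "constrained_curve D \<phi> J q"
begin

lemma open_J: "open J"
  using curve by (simp add: constrained_curve_def)

abbreviation "q' t \<equiv> vector_derivative q (at t)"

lemma q_has_derivative: "t \<in> J \<Longrightarrow> (q has_vector_derivative q' t) (at t)"
  and q'_differentiable: "t \<in> J \<Longrightarrow> q' differentiable (at t)"
  using C2_curve_has_vector_derivative[of q J t] curve by (auto simp: constrained_curve_def)

lemma
  assumes "t \<in> J"
  shows state_in_D: "state_along q t \<in> D"
    and rstate_in_\<Omega>: "rstate_along q t \<in> \<Omega>"
    and q'_Inr: "q' t $ Inr \<nu> = \<alpha> \<nu> (rstate_along q t)"
    and lift_rstate: "lift \<alpha> (rstate_along q t) = state_along q t"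
proof -
  show D: "state_along q t \<in> D"
    using curve assms by (auto simp: constrained_curve_def)
  have \<phi>: "\<forall>\<nu>. \<phi> \<nu> (state_along q t) = 0"
    using curve assms by (auto simp: constrained_curve_def)
  have "rstate_along q t \<in> \<Omega> \<and> (\<forall>\<nu>. q' t $ Inr \<nu> = \<alpha> \<nu> (rstate_along q t))"
    using explicit[of "q t" "q' t" t] D \<phi> unfolding state_along_def rstate_along_def by blast
  then show "rstate_along q t \<in> \<Omega>" and eq: "q' t $ Inr \<nu> = \<alpha> \<nu> (rstate_along q t)" for \<nu>
    by simp_all
  show "lift \<alpha> (rstate_along q t) = state_along q t"
    \<comment> \<open>The dependent velocities equal \<open>\<alpha>\<close>, so lifting restores
      the full velocity. This links the equations in full states with those in reduced
      states.\<close>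
    using join_indep[OF eq] by (simp add: lift_def state_along_def rstate_along_def)
qed

lemma q_differentiable: "t \<in> J \<Longrightarrow> q differentiable (at t)"
  using q_has_derivative vector_derivative_works by blast

lemma indep_q'_differentiable: "t \<in> J \<Longrightarrow> (\<lambda>s. indep (q' s)) differentiable (at t)"
  by (rule differentiable_compose[OF bounded_linear_imp_differentiable[OF bounded_linear_indep] q'_differentiable])

lemma state_along_differentiable: "t \<in> J \<Longrightarrow> state_along q differentiable (at t)"
  unfolding state_along_def
  by (intro differentiable_Pair q_differentiable q'_differentiable differentiable_ident)

lemma rstate_along_differentiable: "t \<in> J \<Longrightarrow> rstate_along q differentiable (at t)"
  unfolding rstate_along_def
  by (intro differentiable_Pair q_differentiable indep_q'_differentiable differentiable_ident)

text \<open>The equations are contracted with the full velocity. The right-hand side becomes a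
  combination of the \<open>v_dv (\<phi> \<nu>)\<close>, which vanish, and only the explicit time
  derivative of \<open>L\<close> is left.\<close>

lemma energy_rate_multiplier:
  assumes eqs: "multiplier_equations T U \<phi> J q" and t: "t \<in> J"
  shows "((\<lambda>s. energy T U \<alpha> (rstate_along q s)) has_real_derivative - d_t L (state_along q t)) (at t)"
proof -
  obtain \<mu> where "\<forall>t\<in>J. \<forall>i. deriv (\<lambda>s. d_v i L (state_along q s)) t - d_q i L (state_along q t)
      = (\<Sum>\<nu>\<in>UNIV. \<mu> \<nu> t * d_v i (\<phi> \<nu>) (state_along q t))"
    using eqs unfolding multiplier_equations_def by blast
  with t have \<mu>: "deriv (\<lambda>s. d_v i L (state_along q s)) t - d_q i L (state_along q t)
      = (\<Sum>\<nu>\<in>UNIV. \<mu> \<nu> t * d_v i (\<phi> \<nu>) (state_along q t))" for i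
    by blast
  have v_dv_\<phi>': "(\<Sum>i\<in>UNIV. q' t $ i * d_v i (\<phi> \<nu>) (state_along q t)) = 0" for \<nu>
    using v_dv_\<phi>[OF rstate_in_\<Omega>[OF t], of \<nu>] lift_rstate[OF t]
    by (simp add: v_dv_def state_along_def)
  have "(\<Sum>i\<in>UNIV. q' t $ i * deriv (\<lambda>s. d_v i L (state_along q s)) t)
      - (\<Sum>i\<in>UNIV. q' t $ i * d_q i L (state_along q t))
      = (\<Sum>i\<in>UNIV. q' t $ i * (\<Sum>\<nu>\<in>UNIV. \<mu> \<nu> t * d_v i (\<phi> \<nu>) (state_along q t)))"
    by (simp add: \<mu>[symmetric] right_diff_distrib sum_subtractf)
  also have "\<dots> = (\<Sum>\<nu>\<in>UNIV. \<mu> \<nu> t * (\<Sum>i\<in>UNIV. q' t $ i * d_v i (\<phi> \<nu>) (state_along q t)))"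
    unfolding sum_distrib_left by (subst sum.swap) (simp add: mult.left_commute)
  finally have power: "(\<Sum>i\<in>UNIV. q' t $ i * deriv (\<lambda>s. d_v i L (state_along q s)) t)
      - (\<Sum>i\<in>UNIV. q' t $ i * d_q i L (state_along q t)) = 0"
    by (simp add: v_dv_\<phi>')
  have "((\<lambda>s. v_dv L (state_along q s) - L (state_along q s)) has_real_derivative
      (\<Sum>i\<in>UNIV. q' t $ i * deriv (\<lambda>s. d_v i L (state_along q s)) t)
      - (\<Sum>i\<in>UNIV. q' t $ i * d_q i L (state_along q t)) - d_t L (state_along q t)) (at t)"
    by (rule v_dv_minus_has_real_derivative[where a = q and b = "q'", folded state_along_def,
          OF L_differentiable[OF state_in_D[OF t]] differentiable_compose[OF
            d_v_L_differentiable[OF state_in_D[OF t]] state_along_differentiable[OF t]]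
          q_has_derivative[OF t] q'_differentiable[OF t]])
  then show ?thesis
    \<comment> \<open>\<open>energy\<close> is evaluated through \<open>lift\<close>, which returns
      \<open>state_along q s\<close> for \<open>s\<close> in \<open>J\<close>; equality on this open
      set suffices for the derivative at \<open>t\<close>.\<close>
    unfolding power
    by (rule has_field_derivative_transform_within_open[OF _ open_J t, THEN DERIV_cong])
      (simp_all add: energy_def lift_rstate)
qed

text \<open>By homogeneity \<open>v_dv (\<alpha> \<nu>) - \<alpha> \<nu>\<close> is zero all along
  the curve. Its derivative, computed by the general formula, is therefore zero too.\<close>

lemma \<alpha>_rate:
  assumes t: "t \<in> J"
  shows "(\<Sum>r\<in>UNIV. q' t $ Inl r * deriv (\<lambda>s. d_v r (\<alpha> \<nu>) (rstate_along q s)) t)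
    = (\<Sum>i\<in>UNIV. q' t $ i * d_q i (\<alpha> \<nu>) (rstate_along q t)) + d_t (\<alpha> \<nu>) (rstate_along q t)"
proof -
  have "((\<lambda>s. v_dv (\<alpha> \<nu>) (rstate_along q s) - \<alpha> \<nu> (rstate_along q s)) has_real_derivative
      (\<Sum>r\<in>UNIV. indep (q' t) $ r * deriv (\<lambda>s. d_v r (\<alpha> \<nu>) (rstate_along q s)) t)
      - (\<Sum>i\<in>UNIV. q' t $ i * d_q i (\<alpha> \<nu>) (rstate_along q t)) - d_t (\<alpha> \<nu>) (rstate_along q t)) (at t)"
    by (rule v_dv_minus_has_real_derivative[where a = q and b = "\<lambda>s. indep (q' s)", folded rstate_along_def,
          OF \<alpha>_differentiable[OF rstate_in_\<Omega>[OF t]] differentiable_compose[OF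
            d_v_\<alpha>_differentiable[OF rstate_in_\<Omega>[OF t]] rstate_along_differentiable[OF t]]
          q_has_derivative[OF t] indep_q'_differentiable[OF t]])
  moreover have "((\<lambda>s. v_dv (\<alpha> \<nu>) (rstate_along q s) - \<alpha> \<nu> (rstate_along q s)) has_real_derivative 0) (at t)"
    by (rule has_field_derivative_transform_within_open[OF DERIV_const[of 0] open_J t])
      (simp add: homogeneous rstate_in_\<Omega>)
  ultimately show ?thesis
    using DERIV_unique by (fastforce simp: indep_def)
qed

lemma sum_d_v_\<alpha>:
  assumes t: "t \<in> J"
  shows "(\<Sum>r\<in>UNIV. q' t $ Inl r * d_v r (\<alpha> \<nu>) (rstate_along q t)) = q' t $ Inr \<nu>"
  using homogeneous[OF rstate_in_\<Omega>[OF t], of \<nu>] q'_Inr[OF t, of \<nu>]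
  by (simp add: v_dv_def rstate_along_def indep_def)

text \<open>In the contracted double sum, \<open>sum_d_v_\<alpha>\<close> turns the inner sums into
  dependent velocities, so the position terms over \<open>Inl\<close> and \<open>Inr\<close>
  together form the full sum in \<open>\<alpha>_rate\<close>. Only the explicit time derivative
  survives.\<close>

lemma sum_B_coeff:
  assumes t: "t \<in> J"
  shows "(\<Sum>r\<in>UNIV. q' t $ Inl r * B_coeff \<alpha> q r \<nu> t) = d_t (\<alpha> \<nu>) (rstate_along q t)"
proof -
  let ?x = "rstate_along q t"
  have "(\<Sum>r\<in>UNIV. q' t $ Inl r * (\<Sum>\<mu>\<in>UNIV. d_v r (\<alpha> \<mu>) ?x * d_q (Inr \<mu>) (\<alpha> \<nu>) ?x))
      = (\<Sum>\<mu>\<in>UNIV. (\<Sum>r\<in>UNIV. q' t $ Inl r * d_v r (\<alpha> \<mu>) ?x) * d_q (Inr \<mu>) (\<alpha> \<nu>) ?x)"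
    unfolding sum_distrib_left sum_distrib_right by (subst sum.swap) (simp add: mult.assoc)
  then show ?thesis
    using \<alpha>_rate[OF t, of \<nu>]
    by (simp add: B_coeff_def right_diff_distrib sum_subtractf sum_UNIV_Plus sum_d_v_\<alpha>[OF t])
qed

text \<open>Contraction with the independent velocities completes the position sum through
  \<open>sum_d_v_\<alpha>\<close>, and \<open>sum_B_coeff\<close> turns the \<open>B_coeff\<close>
  terms into the explicit time dependence of the constraints.\<close>

lemma energy_rate_reduced:
  assumes eqs: "reduced_equations T U \<alpha> J q" and t: "t \<in> J"
  shows "((\<lambda>s. restricted_energy T U \<alpha> (rstate_along q s)) has_real_derivative
    - d_t L' (rstate_along q t)
    + (\<Sum>\<nu>\<in>UNIV. d_t (\<alpha> \<nu>) (rstate_along q t) * d_v (Inr \<nu>) T (state_along q t))) (at t)"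
proof -
  let ?x = "rstate_along q t" and ?v = "\<lambda>r. q' t $ Inl r" and ?T = "\<lambda>\<nu>. d_v (Inr \<nu>) T (state_along q t)"
  have eq: "deriv (\<lambda>s. d_v r L' (rstate_along q s)) t = d_q (Inl r) L' ?x
      + (\<Sum>\<nu>\<in>UNIV. d_q (Inr \<nu>) L' ?x * d_v r (\<alpha> \<nu>) ?x) + (\<Sum>\<nu>\<in>UNIV. B_coeff \<alpha> q r \<nu> t * ?T \<nu>)" for r
    using eqs t unfolding reduced_equations_def lift_rstate[OF t, symmetric]
    by (auto simp: algebra_simps)
  have "(\<Sum>r\<in>UNIV. ?v r * (\<Sum>\<nu>\<in>UNIV. d_q (Inr \<nu>) L' ?x * d_v r (\<alpha> \<nu>) ?x))
      = (\<Sum>\<nu>\<in>UNIV. (\<Sum>r\<in>UNIV. ?v r * d_v r (\<alpha> \<nu>) ?x) * d_q (Inr \<nu>) L' ?x)"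
    unfolding sum_distrib_left sum_distrib_right by (subst sum.swap) (simp add: mult_ac)
  moreover have "(\<Sum>r\<in>UNIV. ?v r * (\<Sum>\<nu>\<in>UNIV. B_coeff \<alpha> q r \<nu> t * ?T \<nu>))
      = (\<Sum>\<nu>\<in>UNIV. (\<Sum>r\<in>UNIV. ?v r * B_coeff \<alpha> q r \<nu> t) * ?T \<nu>)"
    unfolding sum_distrib_left sum_distrib_right by (subst sum.swap) (simp add: mult_ac)
  ultimately have power: "(\<Sum>r\<in>UNIV. indep (q' t) $ r * deriv (\<lambda>s. d_v r L' (rstate_along q s)) t)
      - (\<Sum>i\<in>UNIV. q' t $ i * d_q i L' ?x) = (\<Sum>\<nu>\<in>UNIV. d_t (\<alpha> \<nu>) ?x * ?T \<nu>)"
    by (simp add: eq distrib_left sum.distrib sum_UNIV_Plus sum_d_v_\<alpha>[OF t] sum_B_coeff[OF t] indep_def)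
  have "((\<lambda>s. v_dv L' (rstate_along q s) - L' (rstate_along q s)) has_real_derivative
      (\<Sum>r\<in>UNIV. indep (q' t) $ r * deriv (\<lambda>s. d_v r L' (rstate_along q s)) t)
      - (\<Sum>i\<in>UNIV. q' t $ i * d_q i L' ?x) - d_t L' ?x) (at t)"
    by (rule v_dv_minus_has_real_derivative[where a = q and b = "\<lambda>s. indep (q' s)", folded rstate_along_def,
          OF L'_differentiable[OF rstate_in_\<Omega>[OF t]] differentiable_compose[OF
            d_v_L'_differentiable[OF rstate_in_\<Omega>[OF t]] rstate_along_differentiable[OF t]]
          q_has_derivative[OF t] indep_q'_differentiable[OF t]])
  then show ?thesis
    unfolding power restricted_energy_def by simp
qed

end

section \<open>Energy equations and conservation\<close>

lemma energy_rate:
  assumes motion: "motion D T U \<phi> \<alpha> J q" and t: "t \<in> J"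
  shows "((\<lambda>s. energy T U \<alpha> (rstate_along q s)) has_real_derivative
      - d_t L (lift \<alpha> (rstate_along q t))) (at t)"
    and "((\<lambda>s. restricted_energy T U \<alpha> (rstate_along q s)) has_real_derivative
      - d_t L (lift \<alpha> (rstate_along q t))) (at t)"
proof -
  have curve: "constrained_curve D \<phi> J q"
    using motion by (simp add: motion_def)
  \<comment> \<open>Each form of the equations gives the rate of one energy only. The energies agree
    on \<open>J\<close>, a neighbourhood of \<open>t\<close>, so a rate of either is a rate of
    both.\<close>
  have iff: "((\<lambda>s. energy T U \<alpha> (rstate_along q s)) has_real_derivative d) (at t) \<longleftrightarrow>
      ((\<lambda>s. restricted_energy T U \<alpha> (rstate_along q s)) has_real_derivative d) (at t)" for d
  proof (rule DERIV_cong_ev)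
    show "\<forall>\<^sub>F s in nhds t. energy T U \<alpha> (rstate_along q s) = restricted_energy T U \<alpha> (rstate_along q s)"
      unfolding eventually_nhds
      by (rule exI[of _ J]) (simp add: open_J[OF curve] t energies_eq rstate_in_\<Omega>[OF curve])
  qed simp_all
  show "((\<lambda>s. energy T U \<alpha> (rstate_along q s)) has_real_derivative
      - d_t L (lift \<alpha> (rstate_along q t))) (at t)"
    using motion energy_rate_multiplier[OF curve _ t] energy_rate_reduced[OF curve _ t]
      d_t_L'[OF rstate_in_\<Omega>[OF curve t]]
    by (auto simp: motion_def iff lift_rstate[OF curve t])
  then show "((\<lambda>s. restricted_energy T U \<alpha> (rstate_along q s)) has_real_derivative
      - d_t L (lift \<alpha> (rstate_along q t))) (at t)"
    by (simp add: iff)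
qed

text \<open>The time set is an interval, hence convex, so a vanishing derivative gives a single
  constant.\<close>

lemma energy_conserved:
  assumes motion: "motion D T U \<phi> \<alpha> J q" and stationary: "\<And>x. x \<in> \<Omega> \<Longrightarrow> d_t L (lift \<alpha> x) = 0"
  shows "\<exists>c. \<forall>t\<in>J. energy T U \<alpha> (rstate_along q t) = c \<and> restricted_energy T U \<alpha> (rstate_along q t) = c"
proof -
  have curve: "constrained_curve D \<phi> J q"
    using motion by (simp add: motion_def)
  then have "convex J"
    by (simp add: constrained_curve_def is_interval_convex)
  moreover have "((\<lambda>s. energy T U \<alpha> (rstate_along q s)) has_field_derivative 0) (at t within J)"
    if "t \<in> J" for t
    using energy_rate(1)[OF motion that] stationary[OF rstate_in_\<Omega>[OF curve that]]
    by (auto intro: has_field_derivative_at_within)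
  ultimately obtain c where "\<And>t. t \<in> J \<Longrightarrow> energy T U \<alpha> (rstate_along q t) = c"
    using has_field_derivative_zero_constant[of J "\<lambda>s. energy T U \<alpha> (rstate_along q s)"] by auto
  then show ?thesis
    using energies_eq[OF rstate_in_\<Omega>[OF curve]] by auto
qed

end

theorem proposition4:
  fixes D :: "('m::finite, 'k::finite) state set"
    and \<Omega> :: "('m, 'k) rstate set"
    and T :: "('m, 'k) state \<Rightarrow> real"
    and U :: "(real^('m + 'k)) \<times> real \<Rightarrow> real"
    and \<phi> :: "'k \<Rightarrow> ('m, 'k) state \<Rightarrow> real"
    and \<alpha> :: "'k \<Rightarrow> ('m, 'k) rstate \<Rightarrow> real"
  assumes system: "nonholonomic_system D \<Omega> T U \<phi> \<alpha>"
    and homogeneous: "\<forall>\<nu>. \<forall>(q, v, t)\<in>\<Omega>. (\<Sum>r\<in>UNIV. v $ r * d_v r (\<alpha> \<nu>) (q, v, t)) = \<alpha> \<nu> (q, v, t)"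
  shows
    "(\<forall>x\<in>\<Omega>. v_dv (lagrangian T U) (lift \<alpha> x) = v_dv (restricted_lagrangian T U \<alpha>) x) \<and>
     (\<forall>x\<in>\<Omega>. restricted_energy T U \<alpha> x = energy T U \<alpha> x) \<and>
     (\<forall>J q. motion D T U \<phi> \<alpha> J q \<longrightarrow>
        (\<forall>t\<in>J.
           ((\<lambda>s. energy T U \<alpha> (rstate_along q s)) has_real_derivative
              - d_t (lagrangian T U) (lift \<alpha> (rstate_along q t))) (at t) \<and>
           ((\<lambda>s. restricted_energy T U \<alpha> (rstate_along q s)) has_real_derivative
              - d_t (restricted_lagrangian T U \<alpha>) (rstate_along q t)
              + (\<Sum>\<nu>\<in>UNIV. d_t (\<alpha> \<nu>) (rstate_along q t)
                            * d_v (Inr \<nu>) T (lift \<alpha> (rstate_along q t)))) (at t) \<and>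
           - d_t (restricted_lagrangian T U \<alpha>) (rstate_along q t)
              + (\<Sum>\<nu>\<in>UNIV. d_t (\<alpha> \<nu>) (rstate_along q t)
                            * d_v (Inr \<nu>) T (lift \<alpha> (rstate_along q t)))
             = - d_t (lagrangian T U) (lift \<alpha> (rstate_along q t)))) \<and>
     ((\<forall>x\<in>\<Omega>. d_t (lagrangian T U) (lift \<alpha> x) = 0 \<and> (\<forall>\<nu>. d_t (\<phi> \<nu>) (lift \<alpha> x) = 0)) \<longrightarrow>
        (\<forall>J q. motion D T U \<phi> \<alpha> J q \<longrightarrow>
           (\<exists>c. \<forall>t\<in>J. energy T U \<alpha> (rstate_along q t) = c \<and>
                     restricted_energy T U \<alpha> (rstate_along q t) = c)))"
proof -
  interpret homogeneous_system D \<Omega> T U \<phi> \<alpha>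
    using system homogeneous by unfold_locales (auto simp: v_dv_def case_prod_unfold)
  have rate: "- d_t L' (rstate_along q t) + (\<Sum>\<nu>\<in>UNIV. d_t (\<alpha> \<nu>) (rstate_along q t)
      * d_v (Inr \<nu>) T (lift \<alpha> (rstate_along q t))) = - d_t L (lift \<alpha> (rstate_along q t))"
    if "motion D T U \<phi> \<alpha> J q" "t \<in> J" for J q t
  proof -
    have "constrained_curve D \<phi> J q"
      using that(1) by (simp add: motion_def)
    then show ?thesis
      using that(2) by (intro d_t_L' rstate_in_\<Omega>)
  qed
  show ?thesis
  proof (intro conjI allI ballI impI)
    fix x assume x: "x \<in> \<Omega>"
    show "v_dv L (lift \<alpha> x) = v_dv L' x"
      by (rule v_dv_L[OF x])
    show "restricted_energy T U \<alpha> x = energy T U \<alpha> x"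
      by (rule energies_eq[OF x])
  next
    fix J q t assume mt: "motion D T U \<phi> \<alpha> J q" "t \<in> J"
    note rate = rate[OF mt] and energy_rate = energy_rate[OF mt]
    show "((\<lambda>s. energy T U \<alpha> (rstate_along q s)) has_real_derivative
        - d_t L (lift \<alpha> (rstate_along q t))) (at t)"
      by (rule energy_rate)
    show "((\<lambda>s. restricted_energy T U \<alpha> (rstate_along q s)) has_real_derivative
        - d_t L' (rstate_along q t) + (\<Sum>\<nu>\<in>UNIV. d_t (\<alpha> \<nu>) (rstate_along q t)
          * d_v (Inr \<nu>) T (lift \<alpha> (rstate_along q t)))) (at t)"
      \<comment> \<open>The stated rate is rewritten to \<open>- d_t L\<close> at the lifted state,
        the form in which \<open>energy_rate\<close> gives it.\<close>
      unfolding rate by (rule energy_rate)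
    show "- d_t L' (rstate_along q t) + (\<Sum>\<nu>\<in>UNIV. d_t (\<alpha> \<nu>) (rstate_along q t)
        * d_v (Inr \<nu>) T (lift \<alpha> (rstate_along q t))) = - d_t L (lift \<alpha> (rstate_along q t))"
      by (rule rate)
  next
    fix J q
    assume "\<forall>x\<in>\<Omega>. d_t L (lift \<alpha> x) = 0 \<and> (\<forall>\<nu>. d_t (\<phi> \<nu>) (lift \<alpha> x) = 0)"
      and "motion D T U \<phi> \<alpha> J q"
    then show "\<exists>c. \<forall>t\<in>J. energy T U \<alpha> (rstate_along q t) = c \<and>
        restricted_energy T U \<alpha> (rstate_along q t) = c"
      by (intro energy_conserved) auto
  qed
qed

end
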